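(* Let $F_0,k,b,z_0>0$, $T=\frac{4\pi}{b}$, and $f(z)=\frac{z_0^2}{z_0^2+z^2}$. Then the boundary-value problem $$z'(t)=F_z(t,z(t)),\ t\in[0,T],\qquad z(0)-z(T)=0,$$ possesses at least one solution, which can be extended to a periodic solution (with period $T$) of the equation $z'=F_z(t,z)$.
   Context: Here $V(t,z)=F_0 f(z)\left(\cos\left(kz-\frac{bt}{2}\right)\right)^2$ and $F_z(t,z)=\frac{\partial V}{\partial z}(t,z)$, i.e. $$F_z(t,z)=-kF_0 f(z)\sin(2kz-bt)+F_0\left(\cos\left(kz-\frac{bt}{2}\right)\right)^2 f'(z).$$ A periodic solution with period $T$ is a solution $z:\mathbb{R}\to\mathbb{R}$ of $z'(t)=F_z(t,z(t))$ with $z(t+T)=z(t)$ for all $t$. *)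

theory Defs
  imports "HOL-Analysis.Analysis"
begin

definition envelope :: "real \<Rightarrow> real \<Rightarrow> real" where
  "envelope z0 z = z0^2 / (z0^2 + z^2)"

definition V :: "real \<Rightarrow> real \<Rightarrow> real \<Rightarrow> (real \<Rightarrow> real) \<Rightarrow> real \<Rightarrow> real \<Rightarrow> real" where
  "V F0 k b f t z = F0 * f z * (cos (k * z - b * t / 2))^2"

definition Fz :: "real \<Rightarrow> real \<Rightarrow> real \<Rightarrow> (real \<Rightarrow> real) \<Rightarrow> real \<Rightarrow> real \<Rightarrow> real" where
  "Fz F0 k b f t z = deriv (\<lambda>y. V F0 k b f t y) z"

lemma Fz_eq:
  assumes "f field_differentiable (at z)"
  shows "Fz F0 k b f t z =
    - k * F0 * f z * sin (2 * k * z - b * t)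
    + F0 * (cos (k * z - b * t / 2))^2 * deriv f z"
proof -
  have f: "(f has_real_derivative deriv f z) (at z)"
    using assms by (simp add: field_differentiable_derivI)
  have "2 * k * z - b * t = 2 * (k * z - b * t / 2)"
    by simp
  then have s: "sin (2 * k * z - b * t)
      = 2 * sin (k * z - b * t / 2) * cos (k * z - b * t / 2)"
    by (simp only: sin_double)
  have "((\<lambda>y. V F0 k b f t y) has_real_derivative
      (- k * F0 * f z * sin (2 * k * z - b * t)
       + F0 * (cos (k * z - b * t / 2))^2 * deriv f z)) (at z)"
    unfolding V_def s
    by (rule derivative_eq_intros f refl | simp)+
  then show ?thesis
    unfolding Fz_def by (rule DERIV_imp_deriv)
qed

text \<open>At the endpoints \<open>0\<close> and \<open>T\<close> the derivative is one-sided.\<close>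

definition bvp_solution :: "(real \<Rightarrow> real \<Rightarrow> real) \<Rightarrow> real \<Rightarrow> (real \<Rightarrow> real) \<Rightarrow> bool" where
  "bvp_solution F T z \<longleftrightarrow>
     (\<forall>t\<in>{0..T}. (z has_real_derivative F t (z t)) (at t within {0..T})) \<and>
     z 0 - z T = 0"

definition periodic_solution :: "(real \<Rightarrow> real \<Rightarrow> real) \<Rightarrow> real \<Rightarrow> (real \<Rightarrow> real) \<Rightarrow> bool" where
  "periodic_solution F T z \<longleftrightarrow>
     (\<forall>t. (z has_real_derivative F t (z t)) (at t)) \<and> (\<forall>t. z (t + T) = z t)"

end

theory Submission
  imports Defs
begin

text \<open>
  Both terms of the force decay as \<open>\<bar>z\<bar> \<rightarrow> \<infinity>\<close>, and the dominant one, of order \<open>1/z\<^sup>2\<close>, changes sign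
  during each period, so no interval \<open>[-M, M]\<close> is invariant for an obvious reason. Averaging
  shows what happens far out. At a fixed position \<open>m\<close> the mean of the force over a period is
  \<open>F0 f'(m) / 2\<close>, of order \<open>1/m\<^sup>3\<close> and directed towards the origin. Let \<open>ripple\<close> be the
  zero-mean antiderivative in time of the remaining, oscillating part of the force at \<open>m\<close>. The
  curve \<open>m + ripple\<close> is periodic. Its velocity differs from the force along it by that mean and by
  the error made in evaluating the force at \<open>m\<close> instead of \<open>m + ripple\<close>. The ripple is
  \<open>O(1/m\<^sup>2)\<close>, and so is the derivative of the force in \<open>z\<close>; the error is therefore \<open>O(1/m\<^sup>4)\<close> and
  loses against the mean when \<open>\<bar>m\<bar>\<close> is large (\<open>ripple_error_dominated_by_drift\<close>). Hence the curve at a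
  large \<open>m = M\<close> is a barrier that solutions cross only downwards, and the one at \<open>m = -M\<close> a
  barrier that they cross only upwards.

  A periodic solution between two such barriers is found by monotone iteration
  (\<open>periodic_solution_between_barriers\<close>). With \<open>L\<close> a Lipschitz constant of the force \<open>F\<close> in
  \<open>z\<close>, the equation reads \<open>z' + L z = F t z + L z\<close> with a right-hand side that is increasing in
  \<open>z\<close>. The operator \<open>z' + L z\<close> on periodic functions has an explicit inverse with a positive
  kernel, \<open>periodic_resolvent\<close>, so the resulting fixed-point map is order preserving. Iterated from the
  upper barrier it decreases to a fixed point above the lower barrier.
\<close>

section \<open>Periodic solutions of a linear equation\<close>

text \<open>
  The inverse of \<open>u \<mapsto> u' + L u\<close> on \<open>T\<close>-periodic functions: multiply \<open>u' + L u = g\<close> by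
  the integrating factor, integrate over \<open>[t, t + T]\<close>, and use \<open>u (t + T) = u t\<close>. Moving the
  window to \<open>[0, T]\<close> puts \<open>t\<close> only into the argument of \<open>g\<close>, which makes periodicity and
  monotonicity visible.
\<close>

definition periodic_resolvent :: "real \<Rightarrow> real \<Rightarrow> (real \<Rightarrow> real) \<Rightarrow> real \<Rightarrow> real" where
  "periodic_resolvent L T g t = integral {0..T} (\<lambda>s. exp (L * s) * g (t + s)) / (exp (L * T) - 1)"

lemma periodic_resolvent_periodic:
  assumes "\<And>t. g (t + T) = g t"
  shows "periodic_resolvent L T g (t + T) = periodic_resolvent L T g t"
proof -
  have "g (t + T + s) = g (t + s)" for s
    using assms[of "t + s"] by (simp add: add_ac)
  then show ?thesis
    by (simp add: periodic_resolvent_def)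
qed

lemma resolvent_integrand_integrable:
  fixes g :: "real \<Rightarrow> real"
  assumes "continuous_on UNIV g"
  shows "(\<lambda>s. exp (L * s) * g (t + s)) integrable_on {a..b}"
  by (intro integrable_continuous_interval continuous_intros
      continuous_on_compose2[OF assms] subset_UNIV)

lemma periodic_resolvent_mono:
  assumes "L > 0" "T > 0" "continuous_on UNIV g" "continuous_on UNIV h" "\<And>t. g t \<le> h t"
  shows "periodic_resolvent L T g t \<le> periodic_resolvent L T h t"
  unfolding periodic_resolvent_def using assms
  by (intro divide_right_mono integral_le resolvent_integrand_integrable) auto

text \<open>
  If \<open>A\<close> is an antiderivative of \<open>exp (L x) * g x\<close>, the resolvent is a multiple of
  \<open>exp (- L t) * (A (t + T) - A t)\<close>, whose derivative needs no differentiation under the integral.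
\<close>

lemma periodic_resolvent_has_derivative:
  assumes L: "L > 0" and T: "T > 0" and cont: "continuous_on UNIV g"
    and per: "\<And>t. g (t + T) = g t"
  shows "(periodic_resolvent L T g has_real_derivative g t - L * periodic_resolvent L T g t) (at t)"
proof -
  have "continuous_on UNIV (\<lambda>x. exp (L * x) * g x)"
    by (intro continuous_intros cont)
  then have "isCont (\<lambda>x. exp (L * x) * g x) x" for x
    by (simp add: continuous_on_eq_continuous_at)
  then obtain A where A: "\<And>x. (A has_vector_derivative exp (L * x) * g x) (at x)"
    using einterval_antiderivative[of "-\<infinity>" "\<infinity>" "\<lambda>x. exp (L * x) * g x"] by auto
  then have A': "(A has_real_derivative exp (L * x) * g x) (at x)" for x
    by (simp add: has_real_derivative_iff_has_vector_derivative)
  have shift: "((\<lambda>x. A (x + c)) has_real_derivative exp (L * (t + c)) * g (t + c)) (at t)" for t c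
    using A'[of "t + c"] by (rule DERIV_shift[THEN iffD1])
  have "((\<lambda>s. exp (L * s) * g (t + s)) has_integral
      exp (- L * t) * A (T + t) - exp (- L * t) * A (0 + t)) {0..T}" for t
  proof (rule fundamental_theorem_of_calculus)
    show "((\<lambda>s. exp (- L * t) * A (s + t)) has_vector_derivative exp (L * s) * g (t + s))
        (at s within {0..T})" for s
    proof -
      have "((\<lambda>s. exp (- L * t) * A (s + t)) has_real_derivative
          exp (- L * t) * (exp (L * (s + t)) * g (s + t))) (at s)"
        by (intro DERIV_cmult shift)
      moreover have "exp (- L * t) * (exp (L * (s + t)) * g (s + t)) = exp (L * s) * g (t + s)"
        by (simp add: mult_exp_exp algebra_simps flip: exp_add mult.assoc)
      ultimately show ?thesis
        by (metis has_real_derivative_iff_has_vector_derivative has_vector_derivative_at_within)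
    qed
  qed (use T in simp)
  then have eq: "periodic_resolvent L T g t
      = exp (- L * t) * (A (t + T) - A t) / (exp (L * T) - 1)" for t
    unfolding periodic_resolvent_def
    by (subst integral_unique, assumption) (simp add: algebra_simps)
  have nz: "exp (L * T) - 1 \<noteq> 0"
    using L T by simp
  have d: "((\<lambda>t. exp (- L * t) * (A (t + T) - A t) / (exp (L * T) - 1)) has_real_derivative
      (- L * exp (- L * t) * (A (t + T) - A t)
        + (exp (L * (t + T)) * g (t + T) - exp (L * t) * g t) * exp (- L * t))
      / (exp (L * T) - 1)) (at t)"
    by (rule DERIV_cdivide) (rule derivative_eq_intros shift A' refl | simp)+
  have "(exp (L * (t + T)) * g (t + T) - exp (L * t) * g t) * exp (- L * t)
      = (exp (L * t) * exp (- (L * t))) * (g t * (exp (L * T) - 1))"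
    by (simp only: per distrib_left exp_add) (simp add: algebra_simps)
  also have "\<dots> = g t * (exp (L * T) - 1)"
    by (simp only: exp_minus_inverse mult_1_left)
  finally have "(exp (L * (t + T)) * g (t + T) - exp (L * t) * g t) * exp (- L * t)
      = g t * (exp (L * T) - 1)" .
  then have "(- L * exp (- L * t) * (A (t + T) - A t)
        + (exp (L * (t + T)) * g (t + T) - exp (L * t) * g t) * exp (- L * t))
      / (exp (L * T) - 1) = g t - L * periodic_resolvent L T g t"
    using nz unfolding eq by (simp add: field_simps)
  with d show ?thesis
    unfolding eq[abs_def] by simp
qed

text \<open>
  Together with monotonicity, this turns a differential inequality for a periodic function into
  an inequality between the function and its image under the fixed-point map.
\<close>

lemma periodic_resolvent_inverse:
  assumes L: "L > 0" and T: "T > 0"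
    and der: "\<And>t. (u has_real_derivative u' t) (at t)"
    and per: "\<And>t. u (t + T) = u t"
  shows "periodic_resolvent L T (\<lambda>t. u' t + L * u t) t = u t"
proof -
  have "((\<lambda>s. exp (L * s) * (u' (t + s) + L * u (t + s))) has_integral
      exp (L * T) * u (T + t) - exp (L * 0) * u (0 + t)) {0..T}"
  proof (rule fundamental_theorem_of_calculus)
    show "((\<lambda>s. exp (L * s) * u (s + t)) has_vector_derivative
        exp (L * s) * (u' (t + s) + L * u (t + s))) (at s within {0..T})" for s
    proof -
      have "((\<lambda>s. u (s + t)) has_real_derivative u' (s + t)) (at s)"
        using der[of "s + t"] by (rule DERIV_shift[THEN iffD1])
      then have "((\<lambda>s. exp (L * s) * u (s + t)) has_real_derivative
          exp (L * s) * (u' (t + s) + L * u (t + s))) (at s)"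
        by (auto intro!: derivative_eq_intros simp: algebra_simps)
      then show ?thesis
        by (metis has_real_derivative_iff_has_vector_derivative has_vector_derivative_at_within)
    qed
  qed (use T in simp)
  then have "integral {0..T} (\<lambda>s. exp (L * s) * (u' (t + s) + L * u (t + s)))
      = (exp (L * T) - 1) * u t"
    using per[of t] by (simp add: integral_unique algebra_simps)
  moreover have "exp (L * T) - 1 \<noteq> 0"
    using L T by simp
  ultimately show ?thesis
    by (simp add: periodic_resolvent_def)
qed

section \<open>Ordered barriers enclose a periodic solution\<close>

text \<open>
  The classical method of lower and upper solutions. Convergence of the iterates is only
  pointwise, so continuity of the limit is a separate matter: the iterates have derivatives
  bounded uniformly on compact intervals, and a local Lipschitz bound passes to the limit. The limit is
  then a fixed point by dominated convergence, and a fixed point is a solution because the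
  resolvent inverts \<open>u' + L u\<close>.
\<close>

theorem periodic_solution_between_barriers:
  fixes F :: "real \<Rightarrow> real \<Rightarrow> real"
  assumes L: "L > 0" and T: "T > 0"
    and F_cont: "continuous_on UNIV (\<lambda>p. F (fst p) (snd p))"
    and F_per: "\<And>t z. F (t + T) z = F t z"
    and F_mono: "\<And>t. mono (\<lambda>z. F t z + L * z)"
    and \<alpha>: "\<And>t. (\<alpha> has_real_derivative \<alpha>' t) (at t)" "\<And>t. \<alpha> (t + T) = \<alpha> t"
      "\<And>t. \<alpha>' t \<le> F t (\<alpha> t)" "continuous_on UNIV \<alpha>'"
    and \<beta>: "\<And>t. (\<beta> has_real_derivative \<beta>' t) (at t)" "\<And>t. \<beta> (t + T) = \<beta> t"
      "\<And>t. F t (\<beta> t) \<le> \<beta>' t" "continuous_on UNIV \<beta>'"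
    and \<alpha>\<beta>: "\<And>t. \<alpha> t \<le> \<beta> t"
  shows "\<exists>z. periodic_solution F T z \<and> (\<forall>t. \<alpha> t \<le> z t \<and> z t \<le> \<beta> t)"
proof -
  define G where "G u t = F t (u t) + L * u t" for u t
  define N where "N u = periodic_resolvent L T (G u)" for u
  \<comment> \<open>Fixed points of \<open>N\<close> among the continuous periodic functions are the periodic solutions.\<close>
  define adm where "adm u \<longleftrightarrow> continuous_on UNIV u \<and> (\<forall>t. u (t + T) = u t)" for u :: "real \<Rightarrow> real"
  have G_cont: "continuous_on UNIV (G u)" if "continuous_on UNIV u" for u
  proof -
    have "continuous_on UNIV (\<lambda>t. F (fst (t, u t)) (snd (t, u t)))"
      by (rule continuous_on_compose2[OF F_cont]) (auto intro!: continuous_intros that)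
    then show ?thesis
      unfolding G_def[abs_def] by (auto intro!: continuous_intros that)
  qed
  have G_per: "G u (t + T) = G u t" if "\<And>t. u (t + T) = u t" for u t
    by (simp add: G_def that F_per)
  have G_mono: "G u t \<le> G v t" if "u t \<le> v t" for u v t
    using monoD[OF F_mono that] by (simp add: G_def)
  have N_der: "(N u has_real_derivative G u t - L * N u t) (at t)" if "adm u" for u t
    unfolding N_def using that
    by (intro periodic_resolvent_has_derivative L T G_cont G_per) (auto simp: adm_def)
  have N_adm: "adm (N u)" if "adm u" for u
    using N_der[OF that] that G_per
    by (auto simp: adm_def N_def periodic_resolvent_periodic
        intro!: DERIV_isCont continuous_at_imp_continuous_on)
  have N_mono: "N u t \<le> N v t" if "adm u" "adm v" "\<And>t. u t \<le> v t" for u v t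
    unfolding N_def using that
    by (intro periodic_resolvent_mono L T G_cont G_mono) (auto simp: adm_def)
  have adm_\<alpha>: "adm \<alpha>" and adm_\<beta>: "adm \<beta>"
    using \<alpha>(1,2) \<beta>(1,2)
    by (auto simp: adm_def intro!: DERIV_isCont continuous_at_imp_continuous_on)
  have N_\<alpha>: "\<alpha> t \<le> N \<alpha> t" for t
  proof -
    have "\<alpha> t = periodic_resolvent L T (\<lambda>t. \<alpha>' t + L * \<alpha> t) t"
      by (simp add: periodic_resolvent_inverse[OF L T \<alpha>(1,2)])
    also have "\<dots> \<le> N \<alpha> t"
      unfolding N_def using adm_\<alpha> \<alpha>(3,4)
      by (intro periodic_resolvent_mono L T G_cont continuous_intros) (auto simp: adm_def G_def)
    finally show ?thesis .
  qed
  have N_\<beta>: "N \<beta> t \<le> \<beta> t" for t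
  proof -
    have "N \<beta> t \<le> periodic_resolvent L T (\<lambda>t. \<beta>' t + L * \<beta> t) t"
      unfolding N_def using adm_\<beta> \<beta>(3,4)
      by (intro periodic_resolvent_mono L T G_cont continuous_intros) (auto simp: adm_def G_def)
    also have "\<dots> = \<beta> t"
      by (simp add: periodic_resolvent_inverse[OF L T \<beta>(1,2)])
    finally show ?thesis .
  qed
  define z where "z n = (N ^^ n) \<beta>" for n
  have z_Suc: "z (Suc n) = N (z n)" for n
    by (simp add: z_def)
  have z_adm: "adm (z n)" for n
    by (induction n) (auto simp: z_Suc N_adm adm_\<beta>, simp add: z_def adm_\<beta>)
  have z_ge: "\<alpha> t \<le> z n t" for n t
  proof (induction n arbitrary: t)
    case 0
    then show ?case by (simp add: z_def \<alpha>\<beta>)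
  next
    case (Suc n)
    then show ?case
      using N_\<alpha>[of t] N_mono[OF adm_\<alpha> z_adm, of n t] by (simp add: z_Suc)
  qed
  have z_dec: "z (Suc n) t \<le> z n t" for n t
  proof (induction n arbitrary: t)
    case 0
    then show ?case using N_\<beta> by (simp add: z_def)
  next
    case (Suc n)
    then show ?case
      using N_mono[OF z_adm z_adm, of "Suc n" n t] by (simp add: z_Suc)
  qed
  have z_decseq: "decseq (\<lambda>n. z n t)" for t
    by (intro decseq_SucI z_dec)
  have z_le: "z n t \<le> \<beta> t" for n t
    using decseqD[OF z_decseq, of 0 n t] by (simp add: z_def)
  have "\<exists>l. (\<lambda>n. z n t) \<longlonglongrightarrow> l" for t
    using decseq_convergent[OF z_decseq, of "\<alpha> t"] z_ge by blast
  then obtain w where w: "\<And>t. (\<lambda>n. z n t) \<longlonglongrightarrow> w t"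
    by metis
  have w_per: "w (t + T) = w t" for t
    using w[of t] w[of "t + T"] z_adm by (auto simp: adm_def intro: LIMSEQ_unique)
  have w_ge: "\<alpha> t \<le> w t" and w_le: "w t \<le> \<beta> t" for t
    using LIMSEQ_le_const[OF w] LIMSEQ_le_const2[OF w] z_ge z_le by blast+
  have G_z_bound: "\<bar>G (z n) t\<bar> \<le> \<bar>G \<alpha> t\<bar> + \<bar>G \<beta> t\<bar>" for n t
    using G_mono[of \<alpha> t "z n", OF z_ge] G_mono[of "z n" t \<beta>, OF z_le] by linarith
  have w_cont: "continuous_on UNIV w"
  proof (rule continuous_at_imp_continuous_on, rule ballI)
    fix x :: real
    \<comment> \<open>\<open>C\<close> bounds \<open>G (z n) - L z (n + 1)\<close>, the derivative of \<open>z (n + 1)\<close>, for every \<open>n\<close>.\<close>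
    define I where "I = {x - 1..x + 1}"
    define C where "C t = \<bar>G \<alpha> t\<bar> + \<bar>G \<beta> t\<bar> + L * (\<bar>\<alpha> t\<bar> + \<bar>\<beta> t\<bar>)" for t
    have "continuous_on UNIV C"
      unfolding C_def[abs_def] using adm_\<alpha> adm_\<beta>
      by (intro continuous_intros G_cont) (auto simp: adm_def)
    then have "compact (C ` I)"
      by (intro compact_continuous_image) (auto simp: I_def intro: continuous_on_subset)
    then obtain B where B: "\<And>t. t \<in> I \<Longrightarrow> C t \<le> B"
      using compact_imp_bounded bounded_imp_bdd_above by (metis bdd_above.E image_eqI)
    have lip: "\<bar>z (Suc n) s - z (Suc n) t\<bar> \<le> B * \<bar>s - t\<bar>" if "s \<in> I" "t \<in> I" for n s t
    proof -
      have "norm (z (Suc n) s - z (Suc n) t) \<le> B * norm (s - t)"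
      proof (rule field_differentiable_bound)
        show "convex I" by (simp add: I_def)
        show "(z (Suc n) has_real_derivative G (z n) r - L * z (Suc n) r) (at r within I)" for r
          unfolding z_Suc by (rule has_field_derivative_at_within[OF N_der[OF z_adm]])
        show "norm (G (z n) r - L * z (Suc n) r) \<le> B" if "r \<in> I" for r
        proof -
          have "\<bar>z (Suc n) r\<bar> \<le> \<bar>\<alpha> r\<bar> + \<bar>\<beta> r\<bar>"
            using z_ge[of r "Suc n"] z_le[of "Suc n" r] by linarith
          then have "\<bar>L * z (Suc n) r\<bar> \<le> L * (\<bar>\<alpha> r\<bar> + \<bar>\<beta> r\<bar>)"
            using L by (simp add: abs_mult)
          then show ?thesis
            using G_z_bound[of n r] B[OF that] unfolding C_def real_norm_def by linarith
        qed
      qed (use that in auto)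
      then show ?thesis by simp
    qed
    have "\<bar>w s - w t\<bar> \<le> B * \<bar>s - t\<bar>" if "s \<in> I" "t \<in> I" for s t
    proof (rule LIMSEQ_le_const2)
      show "(\<lambda>n. \<bar>z (Suc n) s - z (Suc n) t\<bar>) \<longlonglongrightarrow> \<bar>w s - w t\<bar>"
        by (intro tendsto_intros LIMSEQ_Suc w)
    qed (use lip that in blast)
    moreover have "B \<ge> 0"
    proof -
      have "0 \<le> C x"
        unfolding C_def using L by (intro add_nonneg_nonneg mult_nonneg_nonneg) auto
      also have "C x \<le> B"
        by (rule B) (simp add: I_def)
      finally show ?thesis .
    qed
    ultimately have "B-lipschitz_on I w"
      by (intro lipschitz_onI) (auto simp: dist_real_def)
    then have "continuous_on I w"
      by (rule lipschitz_on_continuous_on)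
    then show "isCont w x"
      by (rule continuous_on_interior) (simp add: I_def)
  qed
  have w_adm: "adm w"
    by (simp add: adm_def w_cont w_per)
  have w_fix: "w t = N w t" for t
  proof -
    have "(\<lambda>n. integral {0..T} (\<lambda>s. exp (L * s) * G (z n) (t + s)))
        \<longlonglongrightarrow> integral {0..T} (\<lambda>s. exp (L * s) * G w (t + s))"
    proof (rule dominated_convergence(2))
      show "(\<lambda>s. exp (L * s) * G (z n) (t + s)) integrable_on {0..T}" for n
        using z_adm by (intro resolvent_integrand_integrable G_cont) (auto simp: adm_def)
      show "(\<lambda>s. exp (L * s) * (\<bar>G \<alpha> (t + s)\<bar> + \<bar>G \<beta> (t + s)\<bar>)) integrable_on {0..T}"
        using adm_\<alpha> adm_\<beta>
        by (intro resolvent_integrand_integrable[where g = "\<lambda>s. \<bar>G \<alpha> s\<bar> + \<bar>G \<beta> s\<bar>"]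
            continuous_intros G_cont) (auto simp: adm_def)
      show "norm (exp (L * s) * G (z n) (t + s))
          \<le> exp (L * s) * (\<bar>G \<alpha> (t + s)\<bar> + \<bar>G \<beta> (t + s)\<bar>)" for n s
        using G_z_bound by (simp add: abs_mult)
      show "(\<lambda>n. exp (L * s) * G (z n) (t + s)) \<longlonglongrightarrow> exp (L * s) * G w (t + s)" for s
      proof -
        have "isCont (\<lambda>p. F (fst p) (snd p)) (t + s, w (t + s))"
          using F_cont by (simp add: continuous_on_eq_continuous_at)
        then have "(\<lambda>n. F (fst (t + s, z n (t + s))) (snd (t + s, z n (t + s))))
            \<longlonglongrightarrow> F (fst (t + s, w (t + s))) (snd (t + s, w (t + s)))"
          by (rule isCont_tendsto_compose) (intro tendsto_intros w)
        then show ?thesis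
          unfolding G_def by (auto intro!: tendsto_intros w)
      qed
    qed
    then have "(\<lambda>n. N (z n) t) \<longlonglongrightarrow> N w t"
      using L T unfolding N_def periodic_resolvent_def by (intro tendsto_intros) auto
    moreover have "(\<lambda>n. N (z n) t) \<longlonglongrightarrow> w t"
      using LIMSEQ_Suc[OF w[of t]] by (simp add: z_Suc)
    ultimately show ?thesis
      by (metis LIMSEQ_unique)
  qed
  have "N w = w"
    using w_fix by auto
  then have "(w has_real_derivative F t (w t)) (at t)" for t
    using N_der[OF w_adm, of t] by (simp add: G_def)
  then show ?thesis
    using w_per w_ge w_le unfolding periodic_solution_def by blast
qed

section \<open>The force field\<close>

definition envelope_deriv :: "real \<Rightarrow> real \<Rightarrow> real" where
  "envelope_deriv z0 z = - 2 * z0^2 * z / (z0^2 + z^2)^2"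

definition envelope_deriv2 :: "real \<Rightarrow> real \<Rightarrow> real" where
  "envelope_deriv2 z0 z = z0^2 * (6 * z^2 - 2 * z0^2) / (z0^2 + z^2)^3"

lemma envelope_denominator_pos: "z0 > 0 \<Longrightarrow> 0 < z0^2 + (z::real)^2"
  by (simp add: add_pos_nonneg)

lemma envelope_has_derivative:
  assumes "z0 > 0"
  shows "(envelope z0 has_real_derivative envelope_deriv z0 z) (at z)"
  unfolding envelope_def[abs_def] envelope_deriv_def
  using envelope_denominator_pos[OF assms, of z]
  by (auto intro!: derivative_eq_intros simp: power2_eq_square)

lemma envelope_deriv_has_derivative:
  assumes "z0 > 0"
  shows "(envelope_deriv z0 has_real_derivative envelope_deriv2 z0 z) (at z)"
proof -
  define q where "q = z0^2 + z^2"
  have q: "q > 0" unfolding q_def by (rule envelope_denominator_pos[OF assms])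
  have "(envelope_deriv z0 has_real_derivative
      ((- 2 * z0^2) * q^2 - (- 2 * z0^2 * z) * (2 * q * (2 * z))) / (q^2 * q^2)) (at z)"
    unfolding envelope_deriv_def[abs_def] q_def
    by (rule DERIV_divide; (rule derivative_eq_intros refl | simp)+)
       (use assms in simp)
  moreover have "((- 2 * z0^2) * q^2 - (- 2 * z0^2 * z) * (2 * q * (2 * z))) / (q^2 * q^2)
      = z0^2 * (8 * z^2 - 2 * q) / q^3"
    using q by (simp add: field_simps power2_eq_square power3_eq_cube)
  moreover have "8 * z^2 - 2 * q = 6 * z^2 - 2 * z0^2"
    by (simp add: q_def)
  ultimately show ?thesis
    by (simp add: envelope_deriv2_def q_def)
qed

lemma envelope_bound:
  shows "\<bar>envelope z0 z\<bar> \<le> z0^2 / (z0^2 + z^2)"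
  by (simp add: envelope_def)

lemma envelope_deriv_bound:
  assumes "z0 > 0"
  shows "\<bar>envelope_deriv z0 z\<bar> \<le> z0 / (z0^2 + z^2)"
proof -
  define q where "q = z0^2 + z^2"
  have q: "q > 0" unfolding q_def by (rule envelope_denominator_pos[OF assms])
  have "2 * z0 * \<bar>z\<bar> \<le> q"
    using sum_squares_bound[of z0 "\<bar>z\<bar>"] by (simp add: q_def)
  then have "z0 * (2 * z0 * \<bar>z\<bar>) \<le> z0 * q"
    using assms by (intro mult_left_mono) auto
  then have "2 * z0^2 * \<bar>z\<bar> / q^2 \<le> z0 * q / q^2"
    by (intro divide_right_mono) (auto simp: power2_eq_square)
  also have "z0 * q / q^2 = z0 / q"
    using q by (simp add: power2_eq_square)
  finally show ?thesis
    by (simp add: envelope_deriv_def abs_mult q_def)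
qed

lemma envelope_deriv2_bound:
  assumes "z0 > 0"
  shows "\<bar>envelope_deriv2 z0 z\<bar> \<le> 6 / (z0^2 + z^2)"
proof -
  define q where "q = z0^2 + z^2"
  have q: "q > 0" unfolding q_def by (rule envelope_denominator_pos[OF assms])
  have "\<bar>6 * z^2 - 2 * z0^2\<bar> \<le> 6 * q" "z0^2 \<le> q"
    unfolding q_def by (auto simp: abs_le_iff)
  then have "z0^2 * \<bar>6 * z^2 - 2 * z0^2\<bar> \<le> q * (6 * q)"
    using q by (intro mult_mono) auto
  then have "z0^2 * \<bar>6 * z^2 - 2 * z0^2\<bar> / q^3 \<le> q * (6 * q) / q^3"
    using q by (intro divide_right_mono) auto
  then show ?thesis
    using q by (simp add: envelope_deriv2_def abs_mult power3_eq_cube flip: q_def)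
qed

text \<open>
  Doubling the angle separates the part of the force that oscillates in time from its mean
  \<open>F0 * envelope_deriv z0 z / 2\<close>.
\<close>

lemma Fz_envelope:
  assumes "z0 > 0"
  shows "Fz F0 k b (envelope z0) t z =
    - k * F0 * envelope z0 z * sin (2 * k * z - b * t)
    + F0 * (1 + cos (2 * k * z - b * t)) / 2 * envelope_deriv z0 z"
proof -
  have d: "deriv (envelope z0) z = envelope_deriv z0 z"
    by (intro DERIV_imp_deriv envelope_has_derivative assms)
  have "2 * k * z - b * t = 2 * (k * z - b * t / 2)"
    by simp
  then have "cos (2 * k * z - b * t) = cos (2 * (k * z - b * t / 2))"
    by (rule arg_cong)
  then have c: "(cos (k * z - b * t / 2))^2 = (1 + cos (2 * k * z - b * t)) / 2"
    unfolding cos_double_cos by simp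
  have "envelope z0 field_differentiable at z"
    using envelope_has_derivative[OF assms] field_differentiable_def by blast
  then show ?thesis
    by (simp add: Fz_eq d c)
qed

text \<open>
  The envelope and its first two derivatives are all \<open>O(1 / (z0\<^sup>2 + z\<^sup>2))\<close>, hence so is
  the \<open>z\<close>-derivative of the force. A lower bound \<open>r\<close> for \<open>z0\<^sup>2 + z\<^sup>2\<close> on the set serves two purposes:
  \<open>r = z0\<^sup>2\<close> gives a global Lipschitz constant, and a larger \<open>r\<close> the decay far from the origin.
\<close>

lemma Fz_envelope_lipschitz:
  fixes F0 k b z0 :: real
  defines "C \<equiv> F0 * (2 * k^2 * z0^2 + 2 * k * z0 + 6)"
  assumes F0: "F0 > 0" and k: "k > 0" and z0: "z0 > 0"
    and S: "convex S" "x \<in> S" "y \<in> S"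
    and r: "r > 0" "\<And>z. z \<in> S \<Longrightarrow> r \<le> z0^2 + z^2"
  shows "\<bar>Fz F0 k b (envelope z0) t x - Fz F0 k b (envelope z0) t y\<bar> \<le> C / r * \<bar>x - y\<bar>"
proof -
  define F' where "F' z = F0 * (- 2 * k^2 * (envelope z0 z * cos (2 * k * z - b * t))
      - 2 * k * (envelope_deriv z0 z * sin (2 * k * z - b * t))
      + envelope_deriv2 z0 z * ((1 + cos (2 * k * z - b * t)) / 2))" for z
  have "norm (Fz F0 k b (envelope z0) t x - Fz F0 k b (envelope z0) t y) \<le> C / r * norm (x - y)"
  proof (rule field_differentiable_bound[where S = S and f' = F'])
    show "((\<lambda>z. Fz F0 k b (envelope z0) t z) has_real_derivative F' z) (at z within S)" for z
      unfolding Fz_envelope[OF z0] F'_def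
      by (auto intro!: derivative_eq_intros
          envelope_has_derivative[OF z0, THEN has_field_derivative_at_within]
          envelope_deriv_has_derivative[OF z0, THEN has_field_derivative_at_within]
          simp: field_simps power2_eq_square)
    show "norm (F' z) \<le> C / r" if "z \<in> S" for z
    proof -
      define q where "q = z0^2 + z^2"
      define \<theta> where "\<theta> = 2 * k * z - b * t"
      have q: "q > 0" unfolding q_def by (rule envelope_denominator_pos[OF z0])
      have "\<bar>envelope z0 z\<bar> * \<bar>cos \<theta>\<bar> \<le> z0^2 / q * 1"
        using q unfolding q_def by (intro mult_mono envelope_bound) auto
      then have 1: "\<bar>2 * k^2 * (envelope z0 z * cos \<theta>)\<bar> \<le> 2 * k^2 * (z0^2 / q)"
        by (simp only: abs_mult) (simp add: mult_left_mono del: times_divide_eq_right)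
      have "\<bar>envelope_deriv z0 z\<bar> * \<bar>sin \<theta>\<bar> \<le> z0 / q * 1"
        using q z0 unfolding q_def by (intro mult_mono envelope_deriv_bound) auto
      then have 2: "\<bar>2 * k * (envelope_deriv z0 z * sin \<theta>)\<bar> \<le> 2 * k * (z0 / q)"
        using k by (simp only: abs_mult) (simp add: mult_left_mono del: times_divide_eq_right)
      have "\<bar>(1 + cos \<theta>) / 2\<bar> \<le> 1"
        using cos_ge_minus_one[of \<theta>] cos_le_one[of \<theta>] unfolding abs_le_iff by argo
      then have "\<bar>envelope_deriv2 z0 z\<bar> * \<bar>(1 + cos \<theta>) / 2\<bar> \<le> 6 / q * 1"
        using q z0 unfolding q_def by (intro mult_mono envelope_deriv2_bound) auto
      then have 3: "\<bar>envelope_deriv2 z0 z * ((1 + cos \<theta>) / 2)\<bar> \<le> 6 / q"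
        by (simp add: abs_mult)
      have "\<bar>F' z\<bar> = F0 * \<bar>- 2 * k^2 * (envelope z0 z * cos \<theta>)
          - 2 * k * (envelope_deriv z0 z * sin \<theta>) + envelope_deriv2 z0 z * ((1 + cos \<theta>) / 2)\<bar>"
        using F0 by (simp only: F'_def \<theta>_def abs_mult abs_of_pos)
      also have "\<dots> \<le> F0 * (2 * k^2 * (z0^2 / q) + 2 * k * (z0 / q) + 6 / q)"
        using F0 1 2 3 by (intro mult_left_mono) linarith+
      also have "\<dots> = C / q"
        by (simp add: C_def flip: add_divide_distrib)
      also have "\<dots> \<le> C / r"
        using r(1) r(2)[OF that] F0 k z0 unfolding C_def q_def
        by (intro divide_left_mono) (auto intro!: mult_pos_pos add_nonneg_nonneg)
      finally show ?thesis by simp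
    qed
  qed (use S in auto)
  then show ?thesis by simp
qed

section \<open>Barriers far from the origin\<close>

text \<open>
  The zero-mean antiderivative in \<open>t\<close> of the oscillating part of the force at the fixed
  position \<open>m\<close>.
\<close>

definition ripple :: "real \<Rightarrow> real \<Rightarrow> real \<Rightarrow> real \<Rightarrow> real \<Rightarrow> real \<Rightarrow> real" where
  "ripple F0 k b z0 m t = - F0 / b * (k * envelope z0 m * cos (2 * k * m - b * t)
     + envelope_deriv z0 m / 2 * sin (2 * k * m - b * t))"

lemma ripple_has_derivative:
  assumes "b > 0" "z0 > 0"
  shows "(ripple F0 k b z0 m has_real_derivative
    Fz F0 k b (envelope z0) t m - F0 * envelope_deriv z0 m / 2) (at t)"
  unfolding Fz_envelope[OF assms(2)] ripple_def[abs_def]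
  by (rule derivative_eq_intros refl)+ (use assms in \<open>simp add: field_simps\<close>)

lemma ripple_bound:
  assumes "F0 > 0" "k > 0" "b > 0" "z0 > 0"
  shows "\<bar>ripple F0 k b z0 m t\<bar> \<le> F0 / b * (k * z0^2 + z0) / (z0^2 + m^2)"
proof -
  define q where "q = z0^2 + m^2"
  define \<theta> where "\<theta> = 2 * k * m - b * t"
  have q: "q > 0" unfolding q_def by (rule envelope_denominator_pos[OF assms(4)])
  have "\<bar>k * envelope z0 m\<bar> \<le> k * (z0^2 / q)"
    using assms(2) mult_left_mono[OF envelope_bound[of z0 m], of k] by (simp add: abs_mult q_def)
  then have "\<bar>k * envelope z0 m\<bar> * \<bar>cos \<theta>\<bar> \<le> k * (z0^2 / q) * 1"
    using q assms by (intro mult_mono) auto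
  moreover have "\<bar>envelope_deriv z0 m\<bar> / 2 \<le> z0 / q"
    using envelope_deriv_bound[OF assms(4), of m] abs_ge_zero[of "envelope_deriv z0 m"]
    unfolding q_def by argo
  then have "\<bar>envelope_deriv z0 m / 2\<bar> * \<bar>sin \<theta>\<bar> \<le> z0 / q * 1"
    using q assms by (intro mult_mono) auto
  ultimately have "\<bar>k * envelope z0 m\<bar> * \<bar>cos \<theta>\<bar> + \<bar>envelope_deriv z0 m / 2\<bar> * \<bar>sin \<theta>\<bar>
      \<le> k * (z0^2 / q) * 1 + z0 / q * 1"
    by (rule add_mono)
  moreover have "\<bar>k * envelope z0 m * cos \<theta> + envelope_deriv z0 m / 2 * sin \<theta>\<bar>
      \<le> \<bar>k * envelope z0 m\<bar> * \<bar>cos \<theta>\<bar> + \<bar>envelope_deriv z0 m / 2\<bar> * \<bar>sin \<theta>\<bar>"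
    by (simp only: abs_triangle_ineq flip: abs_mult)
  moreover have "k * (z0^2 / q) * 1 + z0 / q * 1 = (k * z0^2 + z0) / q"
    by (simp add: add_divide_distrib)
  ultimately have "\<bar>k * envelope z0 m * cos \<theta> + envelope_deriv z0 m / 2 * sin \<theta>\<bar>
      \<le> (k * z0^2 + z0) / q"
    by linarith
  then have "F0 / b * \<bar>k * envelope z0 m * cos \<theta> + envelope_deriv z0 m / 2 * sin \<theta>\<bar>
      \<le> F0 / b * ((k * z0^2 + z0) / q)"
    using assms by (intro mult_left_mono) auto
  then show ?thesis
    using assms unfolding ripple_def abs_mult q_def \<theta>_def by simp
qed

lemma phase_periodic:
  fixes b t x :: real
  assumes "b > 0" "T = 4 * pi / b"
  shows "cos (x - b * (t + T)) = cos (x - b * t)" "sin (x - b * (t + T)) = sin (x - b * t)"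
proof -
  have "x - b * (t + T) = (x - b * t) - 2 * real 2 * pi"
    using assms by (simp add: algebra_simps)
  then show "cos (x - b * (t + T)) = cos (x - b * t)" "sin (x - b * (t + T)) = sin (x - b * t)"
    by (simp_all only: cos_diff sin_diff cos_2npi sin_2npi) simp_all
qed

lemma ripple_periodic:
  assumes "b > 0" "T = 4 * pi / b"
  shows "ripple F0 k b z0 m (t + T) = ripple F0 k b z0 m t"
  by (simp only: ripple_def phase_periodic[OF assms])

lemma Fz_periodic:
  assumes "b > 0" "z0 > 0" "T = 4 * pi / b"
  shows "Fz F0 k b (envelope z0) (t + T) z = Fz F0 k b (envelope z0) t z"
  by (simp only: Fz_envelope[OF assms(2)] phase_periodic[OF assms(1,3)])

text \<open>
  The derivative of the force is bounded by a multiple of \<open>1/q\<close> with \<open>q = z0\<^sup>2 + m\<^sup>2\<close> as long as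
  the ripple stays below \<open>\<bar>m\<bar> / 2\<close>, and the ripple is another such multiple. The error is thus
  at most a constant over \<open>q\<^sup>2\<close>, while the drift is \<open>F0 z0\<^sup>2 \<bar>m\<bar> / q\<^sup>2\<close>. Stating this for both signs
  of \<open>m\<close> at once serves the upper and the lower barrier.
\<close>

lemma ripple_error_dominated_by_drift:
  assumes F0: "F0 > 0" and k: "k > 0" and b: "b > 0" and z0: "z0 > 0"
  obtains M where "M > 0"
    "\<And>m t. \<bar>m\<bar> \<ge> M \<Longrightarrow> \<bar>ripple F0 k b z0 m t\<bar> \<le> \<bar>m\<bar> / 2"
    "\<And>m t. \<bar>m\<bar> \<ge> M \<Longrightarrow>
      \<bar>Fz F0 k b (envelope z0) t (m + ripple F0 k b z0 m t) - Fz F0 k b (envelope z0) t m\<bar>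
      \<le> F0 * \<bar>envelope_deriv z0 m\<bar> / 2"
proof -
  define C where "C = F0 * (2 * k^2 * z0^2 + 2 * k * z0 + 6)"
  define D where "D = F0 / b * (k * z0^2 + z0)"
  \<comment> \<open>The first summand keeps the ripple below \<open>\<bar>m\<bar> / 2\<close>; the second makes the drift win.\<close>
  define M where "M = 2 * D / z0^2 + 4 * C * D / (F0 * z0^2)"
  have pos: "C > 0" "D > 0"
    unfolding C_def D_def using assms by (auto intro!: mult_pos_pos add_pos_pos divide_pos_pos)
  have M: "M > 0" "M \<ge> 2 * D / z0^2" "M \<ge> 4 * C * D / (F0 * z0^2)"
    unfolding M_def using pos assms by (auto intro!: add_pos_pos)
  have small: "\<bar>ripple F0 k b z0 m t\<bar> \<le> \<bar>m\<bar> / 2" if "\<bar>m\<bar> \<ge> M" for m t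
  proof -
    have "\<bar>ripple F0 k b z0 m t\<bar> \<le> D / (z0^2 + m^2)"
      using ripple_bound[OF assms] by (simp add: D_def)
    also have "\<dots> \<le> D / z0^2"
      using pos z0 by (intro divide_left_mono mult_pos_pos envelope_denominator_pos) auto
    also have "\<dots> \<le> \<bar>m\<bar> / 2"
      using M(2) that by (simp add: mult.commute)
    finally show ?thesis .
  qed
  have "\<bar>Fz F0 k b (envelope z0) t (m + ripple F0 k b z0 m t) - Fz F0 k b (envelope z0) t m\<bar>
      \<le> F0 * \<bar>envelope_deriv z0 m\<bar> / 2" if m: "\<bar>m\<bar> \<ge> M" for m t
  proof -
    define q where "q = z0^2 + m^2"
    define h where "h = ripple F0 k b z0 m t"
    have q: "q > 0" unfolding q_def by (rule envelope_denominator_pos[OF z0])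
    have h: "\<bar>h\<bar> \<le> \<bar>m\<bar> / 2" "\<bar>h\<bar> \<le> D / q"
      using small[OF m] ripple_bound[OF assms] by (auto simp: D_def h_def q_def)
    have "\<bar>Fz F0 k b (envelope z0) t (m + h) - Fz F0 k b (envelope z0) t m\<bar>
        \<le> C / (q / 4) * \<bar>m + h - m\<bar>"
      unfolding C_def
    proof (rule Fz_envelope_lipschitz[OF F0 k z0, where S = "{m - \<bar>m\<bar> / 2..m + \<bar>m\<bar> / 2}"])
      show "q / 4 \<le> z0^2 + z^2" if "z \<in> {m - \<bar>m\<bar> / 2..m + \<bar>m\<bar> / 2}" for z
      proof -
        have "\<bar>m / 2\<bar> \<le> \<bar>z\<bar>"
          using that by (auto simp: abs_if split: if_splits)
        then have "(m / 2)^2 \<le> z^2"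
          by (simp only: abs_le_square_iff)
        then show ?thesis
          using zero_le_power2[of z0] power_divide[of m 2 2] unfolding q_def by (simp, linarith)
      qed
    qed (use h q in auto)
    also have "\<dots> \<le> C / (q / 4) * (D / q)"
      using h pos q by (intro mult_left_mono) auto
    also have "\<dots> = 4 * C * D / q^2"
      by (simp add: power2_eq_square)
    also have "\<dots> \<le> F0 * z0^2 * \<bar>m\<bar> / q^2"
    proof (rule divide_right_mono)
      have "4 * C * D / (F0 * z0^2) \<le> \<bar>m\<bar>"
        using M(3) m by linarith
      then show "4 * C * D \<le> F0 * z0^2 * \<bar>m\<bar>"
        using F0 z0 by (simp add: field_simps)
    qed simp
    also have "\<dots> = F0 * \<bar>envelope_deriv z0 m\<bar> / 2"
      by (simp add: envelope_deriv_def abs_mult q_def)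
    finally show ?thesis by (simp add: h_def)
  qed
  with M(1) small show thesis
    using that by blast
qed

section \<open>Existence of a periodic solution\<close>

theorem theorem6:
  fixes F0 k b z0 T :: real and f :: "real \<Rightarrow> real"
  assumes "F0 > 0" and "k > 0" and "b > 0" and "z0 > 0"
    and "T = 4 * pi / b"
    and "f = envelope z0"
  shows "\<exists>z. bvp_solution (Fz F0 k b f) T z \<and>
           (\<exists>w. periodic_solution (Fz F0 k b f) T w \<and> (\<forall>t\<in>{0..T}. w t = z t))"
proof -
  define F where "F = Fz F0 k b (envelope z0)"
  define h where "h = ripple F0 k b z0"
  define L where "L = F0 * (2 * k^2 * z0^2 + 2 * k * z0 + 6) / z0^2"
  have L: "L > 0"
    unfolding L_def using assms by (auto intro!: mult_pos_pos add_pos_pos divide_pos_pos)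
  have T: "T > 0"
    using assms by simp
  have drift_cont: "continuous_on UNIV (envelope_deriv z0)"
    and envelope_cont: "continuous_on UNIV (envelope z0)"
    using envelope_deriv_has_derivative envelope_has_derivative assms(4)
    by (auto intro!: continuous_at_imp_continuous_on DERIV_isCont)
  have F_cont: "continuous_on UNIV (\<lambda>p. F (fst p) (snd p))"
    unfolding F_def Fz_envelope[OF assms(4)]
    by (intro continuous_intros continuous_on_compose2[OF drift_cont]
        continuous_on_compose2[OF envelope_cont]) auto
  have F_lip: "\<bar>F t x - F t y\<bar> \<le> L * \<bar>x - y\<bar>" for t x y
    unfolding F_def L_def
    by (rule Fz_envelope_lipschitz[OF assms(1,2,4), where S = UNIV]) (use assms in auto)
  have F_mono: "mono (\<lambda>z. F t z + L * z)" for t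
  proof (rule monoI)
    fix x y :: real
    assume "x \<le> y"
    then show "F t x + L * x \<le> F t y + L * y"
      using F_lip[of t x y] by (simp add: algebra_simps)
  qed
  have h_der: "((\<lambda>t. m + h m t) has_real_derivative F t m - F0 * envelope_deriv z0 m / 2) (at t)" for m t
    unfolding h_def F_def using ripple_has_derivative[OF assms(3,4)]
    by (auto intro!: derivative_eq_intros)
  have h_der_cont: "continuous_on UNIV (\<lambda>t. F t m - F0 * envelope_deriv z0 m / 2)" for m
  proof -
    have "continuous_on UNIV (\<lambda>t. F (fst (t, m)) (snd (t, m)))"
      by (rule continuous_on_compose2[OF F_cont]) (auto intro!: continuous_intros)
    then show ?thesis
      by (auto intro!: continuous_intros)
  qed
  obtain M where M: "M > 0" "\<And>m t. \<bar>m\<bar> \<ge> M \<Longrightarrow> \<bar>h m t\<bar> \<le> \<bar>m\<bar> / 2"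
    "\<And>m t. \<bar>m\<bar> \<ge> M \<Longrightarrow> \<bar>F t (m + h m t) - F t m\<bar> \<le> F0 * \<bar>envelope_deriv z0 m\<bar> / 2"
    unfolding F_def h_def using ripple_error_dominated_by_drift[OF assms(1-4)] by metis
  \<comment> \<open>Away from the origin the mean force pulls inwards, on either side.\<close>
  have drift_sign: "envelope_deriv z0 M \<le> 0" "envelope_deriv z0 (- M) \<ge> 0"
    using M(1) by (auto simp: envelope_deriv_def divide_nonpos_nonneg)
  have "\<exists>w. periodic_solution F T w \<and> (\<forall>t. - M + h (- M) t \<le> w t \<and> w t \<le> M + h M t)"
  proof (rule periodic_solution_between_barriers[OF L T F_cont _ F_mono
        h_der _ _ h_der_cont h_der _ _ h_der_cont])
    show "F (t + T) z = F t z" for t z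
      unfolding F_def by (rule Fz_periodic[OF assms(3-5)])
    show "- M + h (- M) (t + T) = - M + h (- M) t" "M + h M (t + T) = M + h M t" for t
      by (simp_all add: h_def ripple_periodic[OF assms(3,5)])
    show "F t (- M) - F0 * envelope_deriv z0 (- M) / 2 \<le> F t (- M + h (- M) t)" for t
      using M(3)[of "- M" t] M(1) drift_sign(2) unfolding abs_le_iff by auto
    show "F t (M + h M t) \<le> F t M - F0 * envelope_deriv z0 M / 2" for t
      using M(3)[of M t] M(1) drift_sign(1) unfolding abs_le_iff by auto
    show "- M + h (- M) t \<le> M + h M t" for t
      using M(2)[of M t] M(2)[of "- M" t] M(1) by (simp add: abs_le_iff)
  qed
  then obtain w where w: "periodic_solution (Fz F0 k b f) T w"
    unfolding F_def assms(6) by blast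
  then have "bvp_solution (Fz F0 k b f) T w"
    unfolding bvp_solution_def periodic_solution_def
    by (metis add_0 diff_self has_field_derivative_at_within)
  with w show ?thesis by blast
qed

end
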